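(* Let $R=\bigoplus_{i=1}^{\infty}R_i$ be a ring graded by the additive semigroup of positive integers. If $R$ is graded-nil, then $R$ is Brown-McCoy radical.
   Context: Rings are associative and are not assumed to have an identity element. A ring graded by the additive semigroup of positive integers is a ring $R$ with a decomposition $R=\bigoplus_{i=1}^{\infty}R_i$ into additive subgroups with $R_iR_j\subseteq R_{i+j}$ for all $i,j\geq 1$. An element is homogeneous if it lies in some $R_i$. A graded ring is graded-nil if all of its homogeneous elements are nilpotent. The Brown-McCoy radical $U(R)$ of a ring $R$ is the intersection of all two-sided ideals $I$ of $R$ such that $R/I$ is a simple (nonzero) ring with an identity element (with $U(R)=R$ if there are no such ideals). A ring $R$ is Brown-McCoy radical if $U(R)=R$; equivalently, $R$ cannot be homomorphically mapped onto a simple ring with an identity element. *)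

theory Defs
  imports "HOL-Algebra.QuotRing"
begin

text \<open>
  The rings of HOL-Algebra are unital, whereas here rings need not have an identity. We
  keep the ring records of HOL-Algebra but require no law for the field \<^const>\<open>one\<close>. Its value
  is therefore meaningless, and nothing below depends on it; in particular the library's
  power operation, which is based on \<^const>\<open>one\<close>, is not used.
\<close>

locale rng = abelian_group R for R (structure) +
  assumes m_closed: "\<lbrakk>x \<in> carrier R; y \<in> carrier R\<rbrakk> \<Longrightarrow> x \<otimes> y \<in> carrier R"
    and m_assoc: "\<lbrakk>x \<in> carrier R; y \<in> carrier R; z \<in> carrier R\<rbrakk>
      \<Longrightarrow> (x \<otimes> y) \<otimes> z = x \<otimes> (y \<otimes> z)"
    and l_distr: "\<lbrakk>x \<in> carrier R; y \<in> carrier R; z \<in> carrier R\<rbrakk>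
      \<Longrightarrow> (x \<oplus> y) \<otimes> z = x \<otimes> z \<oplus> y \<otimes> z"
    and r_distr: "\<lbrakk>x \<in> carrier R; y \<in> carrier R; z \<in> carrier R\<rbrakk>
      \<Longrightarrow> z \<otimes> (x \<oplus> y) = z \<otimes> x \<oplus> z \<otimes> y"

locale rng_ideal = additive_subgroup I R + rng R for I and R (structure) +
  assumes I_l_closed: "\<lbrakk>a \<in> I; x \<in> carrier R\<rbrakk> \<Longrightarrow> x \<otimes> a \<in> I"
    and I_r_closed: "\<lbrakk>a \<in> I; x \<in> carrier R\<rbrakk> \<Longrightarrow> a \<otimes> x \<in> I"

lemma ring_imp_rng: "ring R \<Longrightarrow> rng R"
  by (simp add: ring.axioms(1) ring.ring_simprules rng_axioms_def rng_def)

lemma rng_ideal_iff_ideal: "ring R \<Longrightarrow> rng_ideal I R \<longleftrightarrow> ideal I R"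
  by (simp add: rng_ideal_def ideal_def rng_ideal_axioms_def ideal_axioms_def ring_imp_rng)

context rng_ideal begin

lemma abelian_subgroup: "abelian_subgroup I R"
  by (rule abelian_subgroupI3) (simp_all add: is_additive_subgroup abelian_group_axioms)

interpretation abelian_subgroup I R by (rule abelian_subgroup)

lemma rcoset_mult_add:
  assumes "x \<in> carrier R" "y \<in> carrier R"
  shows "rcoset_mult R I (I +> x) (I +> y) = I +> (x \<otimes> y)"
proof -
  have 1: "I +> (a \<otimes> b) = I +> (x \<otimes> y)" if ab: "a \<in> I +> x" "b \<in> I +> y" for a b
  proof -
    from ab obtain h k where hk: "h \<in> I" "k \<in> I" "a = h \<oplus> x" "b = k \<oplus> y"
      by (auto simp: a_r_coset_def r_coset_def)
    note c = hk(1,2)[THEN a_Hcarr] assms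
    have "a \<otimes> b = (h \<otimes> (k \<oplus> y) \<oplus> x \<otimes> k) \<oplus> x \<otimes> y"
      using c hk by (simp add: m_closed l_distr r_distr a_ac)
    moreover have "h \<otimes> (k \<oplus> y) \<oplus> x \<otimes> k \<in> I" using c hk by (simp add: I_l_closed I_r_closed)
    ultimately have "a \<otimes> b \<in> I +> (x \<otimes> y)" by (auto simp: a_r_coset_def r_coset_def)
    thus ?thesis using a_repr_independence assms m_closed a_subgroup by metis
  qed
  have "x \<in> I +> x" "y \<in> I +> y" using assms a_rcos_self by auto
  thus ?thesis unfolding rcoset_mult_def using 1 by blast
qed

lemma quotient_is_rng: "rng (R Quot I)"
proof (intro rng.intro rng_axioms.intro)
  show "abelian_group (R Quot I)"
    by (rule comm_group_abelian_groupI)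
      (simp add: FactRing_def a_factorgroup_is_comm_group[unfolded A_FactGroup_def'])
qed (auto simp: FactRing_simps rcoset_mult_add m_closed m_assoc a_rcos_sum l_distr r_distr)

end

definition has_identity :: "('a, 'b) ring_scheme \<Rightarrow> bool" where
  "has_identity R \<longleftrightarrow>
     (\<exists>e \<in> carrier R. \<forall>x \<in> carrier R. e \<otimes>\<^bsub>R\<^esub> x = x \<and> x \<otimes>\<^bsub>R\<^esub> e = x)"

text \<open>
  The condition that not all products vanish, sometimes part of the definition of a simple
  ring, is automatic for nonzero rings with identity, the only case in which it matters here.
\<close>
definition simple_rng :: "('a, 'b) ring_scheme \<Rightarrow> bool" where
  "simple_rng R \<longleftrightarrow> rng R \<and> carrier R \<noteq> {\<zero>\<^bsub>R\<^esub>} \<and>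
     (\<forall>J. rng_ideal J R \<longrightarrow> J = {\<zero>\<^bsub>R\<^esub>} \<or> J = carrier R)"

text \<open>Intersecting with the carrier gives the whole ring if there are no such ideals.\<close>
definition brown_mccoy_radical :: "('a, 'b) ring_scheme \<Rightarrow> 'a set" where
  "brown_mccoy_radical R =
     carrier R \<inter> \<Inter>{I. rng_ideal I R \<and> simple_rng (R Quot I) \<and> has_identity (R Quot I)}"

definition brown_mccoy_radical_rng :: "('a, 'b) ring_scheme \<Rightarrow> bool" where
  "brown_mccoy_radical_rng R \<longleftrightarrow> rng R \<and> brown_mccoy_radical R = carrier R"

text \<open>
  \<open>rng_power R x n\<close> is \<open>x\<close> to the power \<open>n + 1\<close>, as there is no zeroth power without an
  identity.
\<close>
primrec rng_power :: "('a, 'b) ring_scheme \<Rightarrow> 'a \<Rightarrow> nat \<Rightarrow> 'a" where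
  "rng_power R x 0 = x"
| "rng_power R x (Suc n) = rng_power R x n \<otimes>\<^bsub>R\<^esub> x"

definition nilpotent :: "('a, 'b) ring_scheme \<Rightarrow> 'a \<Rightarrow> bool" where
  "nilpotent R x \<longleftrightarrow> (\<exists>n. rng_power R x n = \<zero>\<^bsub>R\<^esub>)"

text \<open>
  A grading by the positive integers; the value \<open>A 0\<close> is irrelevant. The internal direct sum
  is expressed by unique decomposition into finitely supported families of components.
\<close>
locale graded_rng = rng R for R (structure) and A :: "nat \<Rightarrow> 'a set" +
  assumes component: "1 \<le> i \<Longrightarrow> additive_subgroup (A i) R"
    and direct_sum: "x \<in> carrier R \<Longrightarrow>
      \<exists>!f. f \<in> (\<Pi>\<^sub>E i\<in>{1..}. A i) \<and> finite {i \<in> {1..}. f i \<noteq> \<zero>} \<and>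
           x = (\<Oplus>i\<in>{i \<in> {1..}. f i \<noteq> \<zero>}. f i)"
    and graded_mult: "\<lbrakk>1 \<le> i; 1 \<le> j; x \<in> A i; y \<in> A j\<rbrakk> \<Longrightarrow> x \<otimes> y \<in> A (i + j)"

definition homogeneous :: "(nat \<Rightarrow> 'a set) \<Rightarrow> 'a \<Rightarrow> bool" where
  "homogeneous A x \<longleftrightarrow> (\<exists>i\<ge>1. x \<in> A i)"

definition graded_nil :: "('a, 'b) ring_scheme \<Rightarrow> (nat \<Rightarrow> 'a set) \<Rightarrow> bool" where
  "graded_nil R A \<longleftrightarrow> (\<forall>x. homogeneous A x \<longrightarrow> nilpotent R x)"

end

theory Submission
  imports Defs
begin

text \<open>
  Suppose that \<open>\<phi>\<close> maps a graded-nil ring \<open>R\<close> onto a simple ring \<open>S\<close> with identity \<open>u\<close>. Let \<open>G\<^sub>n\<close> be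
  the set of those \<open>s\<close> in \<open>S\<close> that, for all large \<open>j\<close>, have a preimage in the window
  \<open>R\<^sub>j\<^sub>+\<^sub>1 + \<dots> + R\<^sub>j\<^sub>+\<^sub>n\<close>. Multiplication by a homogeneous element only shifts windows, so \<open>G\<^sub>n\<close> is
  an ideal (\<open>persistent_ideal\<close>) and hence is \<open>0\<close> or \<open>S\<close>. Clearly \<open>G\<^sub>0 = 0\<close>. On the other hand
  \<open>G\<^sub>n = S\<close> for some \<open>n\<close> (\<open>u_persistent\<close>): if \<open>a\<close> is a preimage of \<open>u\<close> with degrees at most \<open>n\<close>,
  then right multiplication of the lowest component of a preimage of \<open>u\<close> by \<open>a\<close> pushes that component
  up, because all degrees are positive, and does not change the image. Hence there is \<open>n\<close> with
  \<open>G\<^sub>n = 0\<close> and \<open>G\<^sub>n\<^sub>+\<^sub>1 = S\<close>.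

  For this \<open>n\<close>, an element of the kernel of \<open>\<phi>\<close> that lies in a window of length at most \<open>n + 1\<close> has its
  top component \<open>h\<close> in the kernel. Indeed, take preimages of \<open>u\<close> in windows of length \<open>n + 1\<close>. Their
  multiples by \<open>h\<close> are preimages of \<open>\<phi> h\<close> in such windows, and the kernel element serves
  to cancel the top component of these multiples, so \<open>\<phi> h\<close> lies in \<open>G\<^sub>n = 0\<close>
  (\<open>top_component_persistent\<close>).

  Now let \<open>a\<close> be a preimage of \<open>u\<close> in a window of length \<open>n + 1\<close>. For homogeneous \<open>r\<close> the commutator
  \<open>a r - r a\<close> is in the kernel and in a window of length \<open>n + 1\<close>; its top component is \<open>c r - r c\<close>,
  where \<open>c\<close> is the top component of \<open>a\<close>. So \<open>\<phi> c\<close> is central in \<open>S\<close>. It is also nilpotent, because \<open>R\<close> is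
  graded-nil, and a central nilpotent element of \<open>S\<close> is zero. Removing \<open>c\<close> from \<open>a\<close> and repeating the
  argument gives \<open>\<phi> a = 0\<close> (\<open>central_window_vanishes\<close>), which contradicts \<open>\<phi> a = u\<close>.
\<close>

section \<open>Rings without identity\<close>

context rng begin

lemma l_null: "x \<in> carrier R \<Longrightarrow> \<zero> \<otimes> x = \<zero>"
  by (metis add.r_cancel_one' l_distr m_closed r_zero zero_closed)

lemma r_null: "x \<in> carrier R \<Longrightarrow> x \<otimes> \<zero> = \<zero>"
  by (metis add.r_cancel_one' m_closed r_distr r_zero zero_closed)

lemma l_minus:
  assumes "x \<in> carrier R" "y \<in> carrier R"
  shows "(\<ominus> x) \<otimes> y = \<ominus> (x \<otimes> y)"
proof -
  have "(\<ominus> x) \<otimes> y \<oplus> x \<otimes> y = \<zero>"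
    using assms by (simp add: l_distr[symmetric] l_neg l_null)
  then show ?thesis using assms by (simp add: m_closed minus_equality)
qed

lemma r_minus:
  assumes "x \<in> carrier R" "y \<in> carrier R"
  shows "x \<otimes> (\<ominus> y) = \<ominus> (x \<otimes> y)"
proof -
  have "x \<otimes> (\<ominus> y) \<oplus> x \<otimes> y = \<zero>"
    using assms by (simp add: r_distr[symmetric] l_neg r_null)
  then show ?thesis using assms by (simp add: m_closed minus_equality)
qed

lemma rng_power_closed: "x \<in> carrier R \<Longrightarrow> rng_power R x n \<in> carrier R"
  by (induction n) (simp_all add: m_closed)

lemma rng_idealI:
  assumes "J \<subseteq> carrier R" "\<zero> \<in> J"
    and "\<And>x y. \<lbrakk>x \<in> J; y \<in> J\<rbrakk> \<Longrightarrow> x \<oplus> y \<in> J"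
    and "\<And>x. x \<in> J \<Longrightarrow> \<ominus> x \<in> J"
    and "\<And>x r. \<lbrakk>x \<in> J; r \<in> carrier R\<rbrakk> \<Longrightarrow> r \<otimes> x \<in> J"
    and "\<And>x r. \<lbrakk>x \<in> J; r \<in> carrier R\<rbrakk> \<Longrightarrow> x \<otimes> r \<in> J"
  shows "rng_ideal J R"
proof (intro rng_ideal.intro rng_ideal_axioms.intro additive_subgroupI)
  show "subgroup J (add_monoid R)"
    using assms by (intro add.subgroupI) auto
qed (use assms rng_axioms in auto)

end

text \<open>
  The annihilator of a central element \<open>c\<close> is an ideal. If it is everything then \<open>c = u \<otimes> c = \<zero>\<close>;
  if it is zero then \<open>c\<close> is cancellable, and no power of it can vanish unless \<open>c\<close> itself does.
\<close>
lemma central_nilpotent_eq_zero: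
  fixes S (structure)
  assumes simple: "simple_rng S"
    and u: "u \<in> carrier S" "\<And>s. s \<in> carrier S \<Longrightarrow> u \<otimes> s = s"
    and c: "c \<in> carrier S" "nilpotent S c"
    and central: "\<And>s. s \<in> carrier S \<Longrightarrow> c \<otimes> s = s \<otimes> c"
  shows "c = \<zero>"
proof -
  interpret rng S using simple by (simp add: simple_rng_def)
  let ?K = "{s \<in> carrier S. s \<otimes> c = \<zero>}"
  have "rng_ideal ?K S"
  proof (rule rng_idealI)
    fix x r assume x: "x \<in> ?K" and r: "r \<in> carrier S"
    show "r \<otimes> x \<in> ?K" using x r c by (simp add: m_closed m_assoc r_null)
    have "x \<otimes> r \<otimes> c = x \<otimes> c \<otimes> r" using x r c central[of r] m_assoc by (metis (no_types, lifting) mem_Collect_eq)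
    then show "x \<otimes> r \<in> ?K" using x r by (simp add: m_closed l_null)
  qed (use c in \<open>auto simp: l_null l_distr l_minus\<close>)
  then consider "?K = {\<zero>}" | "?K = carrier S" using simple by (auto simp: simple_rng_def)
  then show ?thesis
  proof cases
    case 1
    have "c = \<zero>" if "rng_power S c k = \<zero>" for k
      using that
    proof (induction k)
      case (Suc k)
      then have "rng_power S c k \<in> ?K" using c by (simp add: rng_power_closed)
      then show ?case using 1 Suc.IH by blast
    qed simp
    then show ?thesis using c by (auto simp: nilpotent_def)
  next
    case 2
    then have "u \<otimes> c = \<zero>" using u by blast
    then show ?thesis using u c by simp
  qed
qed

section \<open>Windows of consecutive degrees\<close>

text \<open>
  This is \<open>A\<^sub>j\<^sub>+\<^sub>1 + \<dots> + A\<^sub>j\<^sub>+\<^sub>n\<close>. The recursion adds the components from the bottom up, so that the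
  top component of an element is split off by unfolding; starting at \<open>j + 1\<close> keeps \<open>A 0\<close> out.
\<close>
primrec window :: "('a, 'b) ring_scheme \<Rightarrow> (nat \<Rightarrow> 'a set) \<Rightarrow> nat \<Rightarrow> nat \<Rightarrow> 'a set" where
  "window R A j 0 = {\<zero>\<^bsub>R\<^esub>}"
| "window R A j (Suc n) = window R A j n <+>\<^bsub>R\<^esub> A (Suc (j + n))"

context graded_rng begin

abbreviation W :: "nat \<Rightarrow> nat \<Rightarrow> 'a set" where "W \<equiv> window R A"

lemma component_Suc: "additive_subgroup (A (Suc i)) R"
  by (simp add: component)

lemma component_carrier: "\<lbrakk>1 \<le> i; x \<in> A i\<rbrakk> \<Longrightarrow> x \<in> carrier R"
  using additive_subgroup.a_subset component by blast

lemmas component_Suc_carrier = additive_subgroup.a_Hcarr[OF component_Suc]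

lemma window_subgroup: "additive_subgroup (W j n) R"
proof (induction n)
  case 0
  show ?case by (auto intro!: additive_subgroupI add.subgroupI)
next
  case (Suc n)
  then show ?case by (simp add: add_additive_subgroups component_Suc)
qed

lemmas window_add = additive_subgroup.a_closed[OF window_subgroup]
  and window_zero = additive_subgroup.zero_closed[OF window_subgroup]
  and window_carrier = additive_subgroup.a_Hcarr[OF window_subgroup]

lemma window_minus: "x \<in> W j n \<Longrightarrow> \<ominus> x \<in> W j n"
  by (rule additive_subgroup.a_inv_closed[OF window_subgroup])

lemma window_SucE:
  assumes "x \<in> W j (Suc n)"
  obtains b c where "b \<in> W j n" "c \<in> A (Suc (j + n))" "x = b \<oplus> c"
  using assms by (auto simp: set_add_def')

lemma window_SucI: "\<lbrakk>b \<in> W j n; c \<in> A (Suc (j + n))\<rbrakk> \<Longrightarrow> b \<oplus> c \<in> W j (Suc n)"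
  by (auto simp: set_add_def')

lemma window_mono_right: "W j n \<subseteq> W j (n + d)"
proof (induction d)
  case (Suc d)
  have "x \<in> W j (Suc (n + d))" if "x \<in> W j (n + d)" for x
    using window_SucI[OF that additive_subgroup.zero_closed[OF component_Suc]] that window_carrier
    by simp
  then show ?case using Suc by auto
qed simp

lemma component_subset_window:
  assumes "j < i" "i \<le> j + n"
  shows "A i \<subseteq> W j n"
proof
  fix x assume x: "x \<in> A i"
  then have "x \<in> carrier R" using assms component_carrier[of i] by simp
  then have "x \<in> W j (Suc (i - Suc j))"
    using window_SucI[OF window_zero, of x j "i - Suc j"] x assms by simp
  then show "x \<in> W j n"
    using window_mono_right[of j "i - j" "n - (i - j)"] assms by (auto simp: Suc_diff_Suc)
qed

lemma window_subset:
  assumes "j \<le> i" "i + m \<le> j + n"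
  shows "W i m \<subseteq> W j n"
  using assms(2)
proof (induction m)
  case 0
  show ?case by (simp add: window_zero)
next
  case (Suc m)
  have "A (Suc (i + m)) \<subseteq> W j n" using assms(1) Suc.prems by (intro component_subset_window) auto
  then show ?case using Suc by (auto elim!: window_SucE simp del: window.simps intro!: window_add)
qed

text \<open>
  The remainder \<open>b\<close> is placed in a window that ends one degree above that of \<open>x\<close>: in
  \<open>u_persistent\<close> this window also has to hold the multiples of \<open>c\<close>.
\<close>
lemma window_bottomE:
  assumes "x \<in> W j n"
  obtains c b where "c \<in> A (Suc j)" "b \<in> W (Suc j) n" "x = c \<oplus> b"
  using assms
proof (induction n arbitrary: x thesis)
  case 0
  then show ?case
    using additive_subgroup.zero_closed[OF component_Suc[of j]] by (metis window.simps(1) singletonD l_zero zero_closed window_zero)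
next
  case (Suc n)
  from Suc.prems(2) obtain y d where y: "y \<in> W j n" "d \<in> A (Suc (j + n))" "x = y \<oplus> d"
    by (rule window_SucE)
  obtain c b where cb: "c \<in> A (Suc j)" "b \<in> W (Suc j) n" "y = c \<oplus> b"
    by (rule Suc.IH[OF _ y(1)])
  have car: "c \<in> carrier R" "b \<in> carrier R" "d \<in> carrier R"
    using cb y window_carrier component_Suc_carrier by blast+
  show ?case
  proof (cases n)
    case 0
    then have "b = \<zero>" using cb by simp
    then show ?thesis
      using Suc.prems(1)[of "c \<oplus> d" \<zero>] 0 y cb car window_zero[of "Suc j" "Suc n"]
        additive_subgroup.a_closed[OF component_Suc] by simp
  next
    case (Suc k)
    have "d \<in> W (Suc j) (Suc n)"
      using component_subset_window[of "Suc j" "Suc (j + n)" "Suc n"] Suc y by auto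
    moreover have "b \<in> W (Suc j) (Suc n)"
      using window_subset[of "Suc j" "Suc j" n "Suc n"] cb by auto
    ultimately show ?thesis
      using Suc.prems(1)[of c "b \<oplus> d"] y cb car window_add[of b "Suc j" "Suc n" d]
      by (simp add: a_assoc del: window.simps)
  qed
qed

lemma component_mult_window:
  assumes "1 \<le> k" "x \<in> A k" "b \<in> W j n"
  shows "x \<otimes> b \<in> W (k + j) n"
  using assms(3)
proof (induction n arbitrary: b)
  case 0
  then show ?case using assms component_carrier by (simp add: r_null)
next
  case (Suc n)
  from Suc.prems obtain y d where y: "y \<in> W j n" "d \<in> A (Suc (j + n))" "b = y \<oplus> d"
    by (rule window_SucE)
  have "x \<otimes> d \<in> A (Suc (k + j + n))"
    using graded_mult[of k "Suc (j + n)" x d] assms y by (simp add: add.assoc)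
  moreover have "x \<otimes> b = x \<otimes> y \<oplus> x \<otimes> d"
    using component_carrier[OF assms(1,2)] y component_Suc_carrier window_carrier by (simp add: r_distr)
  ultimately show ?case using window_SucI Suc.IH[OF y(1)] by simp
qed

lemma window_mult_component:
  assumes "1 \<le> k" "x \<in> A k" "b \<in> W j n"
  shows "b \<otimes> x \<in> W (k + j) n"
  using assms(3)
proof (induction n arbitrary: b)
  case 0
  then show ?case using assms component_carrier by (simp add: l_null)
next
  case (Suc n)
  from Suc.prems obtain y d where y: "y \<in> W j n" "d \<in> A (Suc (j + n))" "b = y \<oplus> d"
    by (rule window_SucE)
  have "d \<otimes> x \<in> A (Suc (k + j + n))"
    using graded_mult[of "Suc (j + n)" k d x] assms y by (simp add: ac_simps)
  moreover have "b \<otimes> x = y \<otimes> x \<oplus> d \<otimes> x"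
    using component_carrier[OF assms(1,2)] y component_Suc_carrier window_carrier by (simp add: l_distr)
  ultimately show ?case using window_SucI Suc.IH[OF y(1)] by simp
qed

lemma homogeneous_induct [consumes 1, case_names zero add homogeneous]:
  assumes x: "x \<in> carrier R"
    and zero: "P \<zero>"
    and add: "\<And>x y. \<lbrakk>x \<in> carrier R; y \<in> carrier R; P x; P y\<rbrakk> \<Longrightarrow> P (x \<oplus> y)"
    and homogeneous: "\<And>i x. \<lbrakk>1 \<le> i; x \<in> A i\<rbrakk> \<Longrightarrow> P x"
  shows "P x"
proof -
  obtain f where f: "f \<in> (\<Pi>\<^sub>E i\<in>{1..}. A i)" "finite {i \<in> {1..}. f i \<noteq> \<zero>}"
      "x = (\<Oplus>i\<in>{i \<in> {1..}. f i \<noteq> \<zero>}. f i)"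
    using direct_sum[OF x] by blast
  have "P (\<Oplus>i\<in>F. f i)" if "finite F" "F \<subseteq> {1..}" for F
    using that
  proof (induction F)
    case empty
    then show ?case using zero by simp
  next
    case (insert i F)
    have fA: "f k \<in> A k" if "1 \<le> k" for k using f(1) that by (auto simp: PiE_iff)
    then have "f \<in> F \<rightarrow> carrier R" "f i \<in> carrier R"
      using insert.prems component_carrier by (auto simp: subset_iff)
    then show ?case
      using insert fA homogeneous[of i "f i"] by (auto intro!: add finsum_closed)
  qed
  then show ?thesis using f(2,3) by auto
qed

lemma in_initial_window: "x \<in> carrier R \<Longrightarrow> \<exists>n. x \<in> W 0 n"
proof (induction rule: homogeneous_induct)
  case zero
  show ?case using window_zero by blast
next
  case (add x y)
  then obtain m n where "x \<in> W 0 m" "y \<in> W 0 n" by blast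
  then have "x \<in> W 0 (m + n)" "y \<in> W 0 (m + n)"
    using window_subset[of 0 0 m "m + n"] window_subset[of 0 0 n "m + n"] by auto
  then show ?case using window_add by blast
next
  case (homogeneous i x)
  then show ?case using component_subset_window[of 0 i i] by auto
qed

end

section \<open>Homomorphisms onto simple rings with identity\<close>

locale graded_rng_onto_simple = R: graded_rng R A + S: rng S + abelian_group_hom R S \<phi>
  for R (structure) and A and S (structure) and \<phi> +
  fixes u
  assumes hom_mult: "\<lbrakk>x \<in> carrier R; y \<in> carrier R\<rbrakk> \<Longrightarrow> \<phi> (x \<otimes> y) = \<phi> x \<otimes>\<^bsub>S\<^esub> \<phi> y"
    and onto: "\<phi> ` carrier R = carrier S"
    and simple: "simple_rng S"
    and u_closed: "u \<in> carrier S"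
    and u_left: "s \<in> carrier S \<Longrightarrow> u \<otimes>\<^bsub>S\<^esub> s = s"
    and u_right: "s \<in> carrier S \<Longrightarrow> s \<otimes>\<^bsub>S\<^esub> u = s"
begin

lemma u_nonzero: "u \<noteq> \<zero>\<^bsub>S\<^esub>"
proof
  assume "u = \<zero>\<^bsub>S\<^esub>"
  then have "s = \<zero>\<^bsub>S\<^esub>" if "s \<in> carrier S" for s using u_left[OF that] S.l_null[OF that] by simp
  then have "carrier S = {\<zero>\<^bsub>S\<^esub>}" using S.zero_closed by blast
  then show False using simple by (simp add: simple_rng_def)
qed

text \<open>
  These are the ideals \<open>G\<^sub>n\<close> of the introduction. Asking only for large \<open>j\<close> absorbs the shift of
  windows under multiplication: multiples by elements of degree \<open>k\<close> say nothing about \<open>j < k\<close>.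
\<close>
definition persistent :: "nat \<Rightarrow> 'c set" where
  "persistent n = {s \<in> carrier S. \<exists>N. \<forall>j\<ge>N. s \<in> \<phi> ` R.W j n}"

lemma persistentI:
  "\<lbrakk>s \<in> carrier S; \<And>j. N \<le> j \<Longrightarrow> s \<in> \<phi> ` R.W j n\<rbrakk> \<Longrightarrow> s \<in> persistent n"
  by (auto simp: persistent_def)

text \<open>
  If \<open>b\<close> is a preimage of \<open>x\<close> and \<open>y\<close> has degree \<open>k\<close>, then the products of \<open>b\<close> and \<open>y\<close> lie in a window
  of the same length, shifted by \<open>k\<close>. So homogeneous multipliers preserve persistence, and every
  element of \<open>S\<close> is the image of a sum of homogeneous ones.
\<close>
lemma persistent_ideal: "rng_ideal (persistent n) S"
proof (rule S.rng_idealI)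
  show "persistent n \<subseteq> carrier S" by (auto simp: persistent_def)
  have "\<zero>\<^bsub>S\<^esub> \<in> \<phi> ` R.W j n" for j using R.window_zero hom_zero by (metis image_eqI)
  then show zero_in: "\<zero>\<^bsub>S\<^esub> \<in> persistent n" by (auto simp: persistent_def)
  show add_in: "x \<oplus>\<^bsub>S\<^esub> y \<in> persistent n" if xy: "x \<in> persistent n" "y \<in> persistent n" for x y
  proof -
    obtain M where M: "\<forall>j\<ge>M. x \<in> \<phi> ` R.W j n" using xy by (auto simp: persistent_def)
    obtain N where N: "\<forall>j\<ge>N. y \<in> \<phi> ` R.W j n" using xy by (auto simp: persistent_def)
    have "x \<oplus>\<^bsub>S\<^esub> y \<in> \<phi> ` R.W j n" if "j \<ge> max M N" for j
    proof -
      have "x \<in> \<phi> ` R.W j n" "y \<in> \<phi> ` R.W j n" using M N that by auto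
      then obtain a b where "a \<in> R.W j n" "x = \<phi> a" "b \<in> R.W j n" "y = \<phi> b" by blast
      then show ?thesis using R.window_add[of a j n b] R.window_carrier
        by (intro image_eqI[of _ _ "a \<oplus> b"]) simp_all
    qed
    moreover have "x \<oplus>\<^bsub>S\<^esub> y \<in> carrier S" using xy by (simp add: persistent_def)
    ultimately show ?thesis using persistentI by blast
  qed
  show "\<ominus>\<^bsub>S\<^esub> x \<in> persistent n" if x: "x \<in> persistent n" for x
  proof -
    have "\<ominus>\<^bsub>S\<^esub> x \<in> \<phi> ` R.W j n" if "x \<in> \<phi> ` R.W j n" for j
    proof -
      from that obtain a where a: "a \<in> R.W j n" "x = \<phi> a" by blast
      then show ?thesis
        using R.window_minus R.window_carrier by (intro image_eqI[of _ _ "\<ominus> a"]) simp_all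
    qed
    moreover obtain N where "\<forall>j\<ge>N. x \<in> \<phi> ` R.W j n" "x \<in> carrier S"
      using x by (auto simp: persistent_def)
    ultimately show ?thesis using persistentI[of "\<ominus>\<^bsub>S\<^esub> x" N n] by blast
  qed
  fix x s assume x: "x \<in> persistent n" and s: "s \<in> carrier S"
  then obtain r where r: "r \<in> carrier R" "s = \<phi> r" using onto by blast
  obtain N where N: "\<forall>j\<ge>N. x \<in> \<phi> ` R.W j n" using x by (auto simp: persistent_def)
  have xS: "x \<in> carrier S" using x by (simp add: persistent_def)
  from r(1) have "\<phi> r \<otimes>\<^bsub>S\<^esub> x \<in> persistent n \<and> x \<otimes>\<^bsub>S\<^esub> \<phi> r \<in> persistent n"
  proof (induction rule: R.homogeneous_induct)
    case zero
    then show ?case using zero_in xS by (simp add: S.l_null S.r_null)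
  next
    case (add y z)
    then show ?case using add_in xS
      by (simp add: S.l_distr S.r_distr)
  next
    case (homogeneous k y)
    have yR: "y \<in> carrier R" using homogeneous R.component_carrier by blast
    have "\<phi> y \<otimes>\<^bsub>S\<^esub> x \<in> \<phi> ` R.W j n \<and> x \<otimes>\<^bsub>S\<^esub> \<phi> y \<in> \<phi> ` R.W j n" if j: "j \<ge> k + N" for j
    proof -
      obtain b where b: "b \<in> R.W (j - k) n" "x = \<phi> b" using N j by (metis imageE add_le_imp_le_diff add.commute)
      have "y \<otimes> b \<in> R.W j n" "b \<otimes> y \<in> R.W j n"
        using R.component_mult_window[OF homogeneous b(1)] R.window_mult_component[OF homogeneous b(1)] j
        by simp_all
      moreover have "\<phi> y \<otimes>\<^bsub>S\<^esub> x = \<phi> (y \<otimes> b)" "x \<otimes>\<^bsub>S\<^esub> \<phi> y = \<phi> (b \<otimes> y)"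
        using hom_mult yR R.window_carrier[OF b(1)] b(2) by simp_all
      ultimately show ?thesis by simp
    qed
    then show ?case using persistentI S.m_closed hom_closed[OF yR] xS by blast
  qed
  then show "s \<otimes>\<^bsub>S\<^esub> x \<in> persistent n" "x \<otimes>\<^bsub>S\<^esub> s \<in> persistent n" using r by auto
qed

lemma persistent_eq_zero_if:
  assumes "u \<notin> persistent n"
  shows "persistent n = {\<zero>\<^bsub>S\<^esub>}"
  using simple persistent_ideal[of n] u_closed assms by (auto simp: simple_rng_def)

lemma u_not_persistent_0: "u \<notin> persistent 0"
  using u_nonzero by (auto simp: persistent_def)

text \<open>
  With \<open>a \<in> W 0 n\<close> a preimage of \<open>u\<close>, a preimage \<open>c \<oplus> b\<close> of \<open>u\<close> in \<open>W j n\<close>, where \<open>c\<close> has the lowest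
  degree \<open>j + 1\<close>, can be replaced by \<open>c \<otimes> a \<oplus> b\<close>, in which \<open>c \<otimes> a\<close> has degrees \<open>j + 2, \<dots>, j + 1 + n\<close>.
\<close>
lemma u_persistent: "\<exists>n. u \<in> persistent n"
proof -
  obtain a where a: "a \<in> carrier R" "\<phi> a = u" using onto u_closed by (metis imageE)
  obtain n where n: "a \<in> R.W 0 n" using R.in_initial_window[OF a(1)] by (elim exE)
  have "u \<in> \<phi> ` R.W j n" for j
  proof (induction j)
    case 0
    from a(2)[symmetric] n show ?case by (rule image_eqI)
  next
    case (Suc j)
    then obtain x where x: "x \<in> R.W j n" "\<phi> x = u" by auto
    obtain c b where cb: "c \<in> A (Suc j)" "b \<in> R.W (Suc j) n" "x = c \<oplus> b"
      by (rule R.window_bottomE[OF x(1)])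
    have car: "c \<in> carrier R" "b \<in> carrier R"
      using cb R.window_carrier R.component_Suc_carrier by blast+
    have "c \<otimes> a \<oplus> b \<in> R.W (Suc j) n"
      using R.component_mult_window[OF _ cb(1) n] cb(2) by (simp add: R.window_add)
    moreover have "\<phi> (c \<otimes> a \<oplus> b) = u"
      using car a x cb by (simp add: hom_mult R.m_closed u_right)
    ultimately show ?case by (intro image_eqI[of _ _ "c \<otimes> a \<oplus> b"]) simp_all
  qed
  then have "u \<in> persistent n" by (intro persistentI u_closed)
  then show ?thesis ..
qed

text \<open>
  Write a preimage of \<open>u\<close> in a window of length \<open>n + 1\<close> as \<open>b \<oplus> c\<close> with top component \<open>c\<close>. Then
  \<open>h \<otimes> (b \<oplus> c)\<close> is a preimage of \<open>\<phi> h\<close> with top component \<open>h \<otimes> c\<close>. As \<open>\<phi> h = - \<phi> m\<close>, this component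
  can be traded for \<open>- m \<otimes> c\<close>. Its degrees are lower than that of \<open>h \<otimes> c\<close> by at most \<open>l \<le> n\<close>, so it
  fits into the window of \<open>h \<otimes> b\<close>, whose length is only \<open>n\<close>.
\<close>
lemma top_component_persistent:
  assumes u: "u \<in> persistent (Suc n)"
    and m: "m \<in> R.W p l" "h \<in> A (Suc (p + l))" "l \<le> n"
    and vanish: "\<phi> (m \<oplus> h) = \<zero>\<^bsub>S\<^esub>"
  shows "\<phi> h \<in> persistent n"
proof -
  obtain N where N: "\<forall>j\<ge>N. u \<in> \<phi> ` R.W j (Suc n)" using u by (auto simp: persistent_def)
  have car: "m \<in> carrier R" "h \<in> carrier R" using m R.window_carrier R.component_Suc_carrier by blast+
  have "\<phi> h \<in> \<phi> ` R.W j n" if j: "j \<ge> Suc (p + l) + N" for j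
  proof -
    define i where "i = j - Suc (p + l)"
    have i: "i \<ge> N" "j = Suc (p + l) + i" using j by (auto simp: i_def)
    then obtain a where a: "a \<in> R.W i (Suc n)" "\<phi> a = u" using N by auto
    obtain b c where bc: "b \<in> R.W i n" "c \<in> A (Suc (i + n))" "a = b \<oplus> c"
      by (rule R.window_SucE[OF a(1)])
    have car': "b \<in> carrier R" "c \<in> carrier R" using bc R.window_carrier R.component_Suc_carrier by blast+
    have "h \<otimes> b \<in> R.W j n" using R.component_mult_window[OF _ m(2) bc(1)] i by simp
    moreover have "m \<otimes> c \<in> R.W j n"
      using R.window_mult_component[OF _ bc(2) m(1)] i m(3)
        R.window_subset[of j "Suc (i + n) + p" l n] by auto
    ultimately have "h \<otimes> b \<oplus> \<ominus> (m \<otimes> c) \<in> R.W j n" by (simp add: R.window_add R.window_minus)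
    moreover have "\<phi> (h \<otimes> b \<oplus> \<ominus> (m \<otimes> c)) = \<phi> h"
    proof -
      have "\<phi> h = \<ominus>\<^bsub>S\<^esub> \<phi> m" using vanish car
        by (metis S.a_comm S.minus_equality hom_add hom_closed)
      then have "\<phi> h \<otimes>\<^bsub>S\<^esub> \<phi> c = \<ominus>\<^bsub>S\<^esub> (\<phi> m \<otimes>\<^bsub>S\<^esub> \<phi> c)" using car car' by (simp add: S.l_minus)
      then have "\<phi> (h \<otimes> b \<oplus> \<ominus> (m \<otimes> c)) = \<phi> h \<otimes>\<^bsub>S\<^esub> \<phi> b \<oplus>\<^bsub>S\<^esub> \<phi> h \<otimes>\<^bsub>S\<^esub> \<phi> c"
        using car car' by (simp add: hom_mult R.m_closed)
      also have "\<dots> = \<phi> h \<otimes>\<^bsub>S\<^esub> \<phi> a" using car car' bc by (simp add: S.r_distr)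
      finally show ?thesis using a car u_right by simp
    qed
    ultimately show ?thesis by (intro image_eqI[of _ _ "h \<otimes> b \<oplus> \<ominus> (m \<otimes> c)"]) simp_all
  qed
  then show ?thesis by (intro persistentI hom_closed[OF car(2)])
qed

lemma hom_rng_power: "x \<in> carrier R \<Longrightarrow> \<phi> (rng_power R x n) = rng_power S (\<phi> x) n"
  by (induction n) (simp_all add: hom_mult R.rng_power_closed)

lemma central_if_commutes_with_homogeneous:
  assumes s: "s \<in> carrier S"
    and comm: "\<And>k r. \<lbrakk>1 \<le> k; r \<in> A k\<rbrakk> \<Longrightarrow> s \<otimes>\<^bsub>S\<^esub> \<phi> r = \<phi> r \<otimes>\<^bsub>S\<^esub> s"
    and t: "t \<in> carrier S"
  shows "s \<otimes>\<^bsub>S\<^esub> t = t \<otimes>\<^bsub>S\<^esub> s"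
proof -
  obtain r where r: "r \<in> carrier R" "t = \<phi> r" using onto t by blast
  from r(1) have "s \<otimes>\<^bsub>S\<^esub> \<phi> r = \<phi> r \<otimes>\<^bsub>S\<^esub> s"
  proof (induction rule: R.homogeneous_induct)
    case zero
    then show ?case using s by (simp add: S.l_null S.r_null)
  next
    case (add x y)
    then show ?case using s by (simp add: S.l_distr S.r_distr)
  qed (rule comm)
  then show ?thesis using r by simp
qed

text \<open>
  The induction removes top components. The top component \<open>c\<close> of \<open>b\<close> has a central image because
  \<open>c \<otimes> r - r \<otimes> c\<close> is the top component of the kernel element \<open>b \<otimes> r - r \<otimes> b\<close>; then \<open>\<phi> c = \<zero>\<close> by
  nilpotency, and the rest of \<open>b\<close> has the same image as \<open>b\<close>, so it is again central.
\<close>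
lemma central_window_vanishes:
  assumes nil: "graded_nil R A"
    and u: "u \<in> persistent (Suc n)" "u \<notin> persistent n"
    and b: "b \<in> R.W j l" "l \<le> Suc n"
    and central: "\<And>s. s \<in> carrier S \<Longrightarrow> \<phi> b \<otimes>\<^bsub>S\<^esub> s = s \<otimes>\<^bsub>S\<^esub> \<phi> b"
  shows "\<phi> b = \<zero>\<^bsub>S\<^esub>"
  using b central
proof (induction l arbitrary: b)
  case 0
  then show ?case by simp
next
  case (Suc l)
  from Suc.prems(1) obtain d c where dc: "d \<in> R.W j l" "c \<in> A (Suc (j + l))" "b = d \<oplus> c"
    by (rule R.window_SucE)
  have car: "d \<in> carrier R" "c \<in> carrier R" using dc R.window_carrier R.component_Suc_carrier by blast+
  have comm: "\<phi> c \<otimes>\<^bsub>S\<^esub> \<phi> r = \<phi> r \<otimes>\<^bsub>S\<^esub> \<phi> c" if r: "1 \<le> k" "r \<in> A k" for k r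
  proof -
    have rR: "r \<in> carrier R" using r R.component_carrier by blast
    let ?d = "d \<otimes> r \<oplus> \<ominus> (r \<otimes> d)" and ?c = "c \<otimes> r \<oplus> \<ominus> (r \<otimes> c)"
    have "?d \<in> R.W (k + j) l"
      using R.component_mult_window[OF r dc(1)] R.window_mult_component[OF r dc(1)]
      by (simp add: R.window_add R.window_minus)
    moreover have "?c \<in> A (Suc (k + j + l))"
    proof -
      interpret C: additive_subgroup "A (Suc (k + j + l))" R by (rule R.component_Suc)
      have "c \<otimes> r \<in> A (Suc (k + j + l))" "r \<otimes> c \<in> A (Suc (k + j + l))"
        using R.graded_mult[OF _ r(1) dc(2) r(2)] R.graded_mult[OF r(1) _ r(2) dc(2)]
        by (simp_all add: ac_simps)
      then show ?thesis by simp
    qed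
    moreover have "\<phi> (?d \<oplus> ?c) = \<zero>\<^bsub>S\<^esub>"
    proof -
      have "?d \<oplus> ?c = b \<otimes> r \<oplus> \<ominus> (r \<otimes> b)"
        using car rR dc(3)
        by (simp add: R.l_distr R.r_distr R.m_closed R.minus_add R.a_ac)
      then show ?thesis
        using Suc.prems(3)[of "\<phi> r"] car rR dc(3) by (simp add: hom_mult R.m_closed S.r_neg S.m_closed)
    qed
    ultimately have "\<phi> ?c \<in> persistent n"
      using top_component_persistent[OF u(1)] Suc.prems(2) by blast
    then have "\<phi> ?c = \<zero>\<^bsub>S\<^esub>" using persistent_eq_zero_if[OF u(2)] by blast
    then have "\<phi> c \<otimes>\<^bsub>S\<^esub> \<phi> r \<oplus>\<^bsub>S\<^esub> \<ominus>\<^bsub>S\<^esub> (\<phi> r \<otimes>\<^bsub>S\<^esub> \<phi> c) = \<zero>\<^bsub>S\<^esub>"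
      using car rR by (simp add: hom_mult R.m_closed)
    then have "\<ominus>\<^bsub>S\<^esub> (\<ominus>\<^bsub>S\<^esub> (\<phi> r \<otimes>\<^bsub>S\<^esub> \<phi> c)) = \<phi> c \<otimes>\<^bsub>S\<^esub> \<phi> r"
      using car rR by (intro S.minus_equality) (simp_all add: S.m_closed)
    then show ?thesis using car rR by (simp add: S.m_closed)
  qed
  have "homogeneous A c" unfolding homogeneous_def using dc(2) by (intro exI[of _ "Suc (j + l)"]) simp
  then have "nilpotent R c" using nil by (simp add: graded_nil_def)
  then have "nilpotent S (\<phi> c)"
    unfolding nilpotent_def using hom_rng_power[OF car(2)] hom_zero by metis
  then have c0: "\<phi> c = \<zero>\<^bsub>S\<^esub>"
    using central_nilpotent_eq_zero[OF simple u_closed u_left]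
      central_if_commutes_with_homogeneous[OF _ comm] car by simp
  then have "\<phi> b = \<phi> d" using dc car by simp
  then show ?case using Suc.IH[OF dc(1)] Suc.prems by simp
qed

text \<open>
  The identity is central, so the preceding lemma applies to a preimage of it in a shortest
  possible window.
\<close>
lemma not_graded_nil: "\<not> graded_nil R A"
proof
  assume nil: "graded_nil R A"
  define n where "n = (LEAST n. u \<in> persistent n)"
  have n: "u \<in> persistent n" unfolding n_def using u_persistent by (rule LeastI_ex)
  then obtain k where k: "n = Suc k" using u_not_persistent_0 by (cases n) auto
  have not_k: "u \<notin> persistent k" using not_less_Least[of k "\<lambda>n. u \<in> persistent n"] k n_def by simp
  from n obtain j a where "a \<in> R.W j n" "\<phi> a = u" by (auto simp: persistent_def)
  then have "u = \<zero>\<^bsub>S\<^esub>"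
    using central_window_vanishes[OF nil _ not_k, of a j n] n k u_left u_right by auto
  then show False using u_nonzero by simp
qed

end

theorem proposition3p1:
  fixes R :: "('a, 'b) ring_scheme" and A :: "nat \<Rightarrow> 'a set"
  assumes "graded_rng R A"
    and "graded_nil R A"
  shows "brown_mccoy_radical_rng R"
proof -
  interpret R: graded_rng R A by fact
  have False if I: "rng_ideal I R" "simple_rng (R Quot I)" "has_identity (R Quot I)" for I
  proof -
    interpret I: rng_ideal I R by fact
    interpret S: rng "R Quot I" by (rule I.quotient_is_rng)
    obtain u where u: "u \<in> carrier (R Quot I)"
      "\<forall>s \<in> carrier (R Quot I). u \<otimes>\<^bsub>R Quot I\<^esub> s = s \<and> s \<otimes>\<^bsub>R Quot I\<^esub> u = s"
      using I(3) by (auto simp: has_identity_def)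
    have add: "(I +>\<^bsub>R\<^esub> x) \<oplus>\<^bsub>R Quot I\<^esub> (I +>\<^bsub>R\<^esub> y) = I +>\<^bsub>R\<^esub> (x \<oplus>\<^bsub>R\<^esub> y)"
      if "x \<in> carrier R" "y \<in> carrier R" for x y
      using that abelian_subgroup.a_rcos_sum[OF I.abelian_subgroup] by (simp add: FactRing_def)
    have onto: "(+>\<^bsub>R\<^esub>) I ` carrier R = carrier (R Quot I)"
      by (auto simp: FactRing_def A_RCOSETS_def')
    have "group_hom (add_monoid R) (add_monoid (R Quot I)) ((+>\<^bsub>R\<^esub>) I)"
    proof (intro group_hom.intro group_hom_axioms.intro)
      show "group (add_monoid R)" by (rule R.a_group)
      show "group (add_monoid (R Quot I))" by (rule S.a_group)
      show "(+>\<^bsub>R\<^esub>) I \<in> hom (add_monoid R) (add_monoid (R Quot I))"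
        using onto add by (auto simp: hom_def)
    qed
    then have "abelian_group_hom R (R Quot I) ((+>\<^bsub>R\<^esub>) I)"
      by (intro abelian_group_homI R.abelian_group_axioms S.abelian_group_axioms)
    moreover have "graded_rng_onto_simple_axioms R (R Quot I) ((+>\<^bsub>R\<^esub>) I) u"
      using onto u I(2) I.rcoset_mult_add
      by (intro graded_rng_onto_simple_axioms.intro) (auto simp: FactRing_def)
    ultimately interpret graded_rng_onto_simple R A "R Quot I" "(+>\<^bsub>R\<^esub>) I" u
      by (intro graded_rng_onto_simple.intro assms(1) S.rng_axioms)
    show False using not_graded_nil assms(2) by blast
  qed
  then have no_ideals: "{I. rng_ideal I R \<and> simple_rng (R Quot I) \<and> has_identity (R Quot I)} = {}"
    by blast
  show ?thesis
    unfolding brown_mccoy_radical_rng_def brown_mccoy_radical_def no_ideals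
    using R.rng_axioms by simp
qed

end
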